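(* The map $\|\cdot\|:\overline{\mathbb{IR}}\to\mathbb{R}$ given by $$\|\mathcal{X}\|=l(\mathcal{X})+|c(\mathcal{X})|$$ for any $\mathcal{X}\in\overline{\mathbb{IR}}$ is a norm on the real vector space $\overline{\mathbb{IR}}$.
   Context: $\mathbb{IR}$ is the set of intervals $[a,b]$ with real $a\le b$ (degenerate intervals allowed), with addition $[a,b]+[c,d]=[a+c,b+d]$ and, for $\alpha\ge 0$, $\alpha[a,b]=[\alpha a,\alpha b]$; $0$ also denotes $[0,0]$. $\overline{\mathbb{IR}}$ is the quotient of $\mathbb{IR}\times\mathbb{IR}$ by $(x,y)\sim(z,t)\iff x+t=y+z$; the class of $(x,y)$ is $\overline{(x,y)}$, and $\overline{(x,y)}+\overline{(z,t)}=\overline{(x+z,y+t)}$. Every element of $\overline{\mathbb{IR}}$ can be written $\overline{(A,0)}$ or $\overline{(0,A)}$ with $A\in\mathbb{IR}$. $\overline{\mathbb{IR}}$ is a real vector space with scalar multiplication: for $\alpha\ge 0$, $\alpha\overline{(A,0)}=\overline{(\alpha A,0)}$, $\alpha\overline{(0,A)}=\overline{(0,\alpha A)}$; for $\alpha<0$, $\alpha\overline{(A,0)}=\overline{(0,(-\alpha)A)}$, $\alpha\overline{(0,A)}=\overline{((-\alpha)A,0)}$. For $A=[a,b]\in\mathbb{IR}$, $l(A)=b-a$ and $c(A)=\frac{a+b}{2}$. If $\mathcal{X}=\overline{(A,0)}$ then $l(\mathcal{X})=l(A)$, $c(\mathcal{X})=c(A)$; if $\mathcal{X}=\overline{(0,A)}$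 then $l(\mathcal{X})=l(A)$, $c(\mathcal{X})=-c(A)$. *)

theory Defs
  imports Complex_Main "HOL-Library.Interval"
begin

text \<open>
  The type \<^typ>\<open>real interval\<close> of the library consists of the intervals \<open>[a, b]\<close> with \<open>a \<le> b\<close>; its
  addition is componentwise on the bounds, \<open>0\<close> is \<open>[0, 0]\<close>, and \<^const>\<open>width\<close> is the length \<open>b - a\<close>.
\<close>

text \<open>
  Only meant for \<open>0 \<le> \<alpha>\<close>: for negative \<open>\<alpha>\<close> and a nondegenerate interval the bounds are in the
  wrong order and the value is unspecified.
\<close>

definition scale_interval :: "real \<Rightarrow> real interval \<Rightarrow> real interval"
  where "scale_interval \<alpha> A = Interval (\<alpha> * lower A, \<alpha> * upper A)"

definition center :: "real interval \<Rightarrow> real"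
  where "center A = (lower A + upper A) / 2"

lemma lower_scale_interval: "0 \<le> \<alpha> \<Longrightarrow> lower (scale_interval \<alpha> A) = \<alpha> * lower A"
  and upper_scale_interval: "0 \<le> \<alpha> \<Longrightarrow> upper (scale_interval \<alpha> A) = \<alpha> * upper A"
  by (simp_all add: scale_interval_def lower.rep_eq upper.rep_eq Interval_inverse mult_left_mono
      lower_le_upper[unfolded lower.rep_eq upper.rep_eq])

definition diff_rel :: "real interval \<times> real interval \<Rightarrow> real interval \<times> real interval \<Rightarrow> bool"
  where "diff_rel = (\<lambda>(x, y) (z, t). x + t = y + z)"

lemma diff_rel_bounds:
  "diff_rel p q \<longleftrightarrow>
     lower (fst p) + lower (snd q) = lower (snd p) + lower (fst q) \<and>
     upper (fst p) + upper (snd q) = upper (snd p) + upper (fst q)"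
  by (auto simp: diff_rel_def interval_eq_iff split: prod.splits)

quotient_type diff_interval = "real interval \<times> real interval" / diff_rel
  by (intro equivpI reflpI sympI transpI) (auto simp: diff_rel_bounds)

lift_definition diff_class :: "real interval \<Rightarrow> real interval \<Rightarrow> diff_interval"
  is "\<lambda>x y. (x, y)" .

lemma diff_class_eq_iff: "diff_class x y = diff_class z t \<longleftrightarrow> x + t = y + z"
  by transfer (simp add: diff_rel_def)

lemma diff_class_eq_iff_bounds:
  "diff_class x y = diff_class z t \<longleftrightarrow>
     lower x + lower t = lower y + lower z \<and> upper x + upper t = upper y + upper z"
  by (simp add: diff_class_eq_iff interval_eq_iff)

lemma diff_class_exhaust:
  obtains x y where "X = diff_class x y"
proof -
  have "\<exists>x y. X = diff_class x y"
    by transfer (metis surj_pair diff_interval.abs_eq_iff)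
  with that show thesis by blast
qed

lemma diff_interval_cases:
  obtains (pos) A where "X = diff_class A 0" | (neg) A where "X = diff_class 0 A"
proof -
  obtain x y where X: "X = diff_class x y"
    by (rule diff_class_exhaust)
  show thesis
  proof (cases "width y \<le> width x")
    case True
    then have le: "lower x - lower y \<le> upper x - upper y"
      by (simp add: width_def)
    let ?A = "Interval (lower x - lower y, upper x - upper y)"
    have "lower ?A = lower x - lower y" "upper ?A = upper x - upper y"
      using le by (simp_all add: lower.rep_eq upper.rep_eq Interval_inverse)
    then have "X = diff_class ?A 0"
      by (simp add: X diff_class_eq_iff_bounds)
    then show thesis by (rule pos)
  next
    case False
    then have le: "lower y - lower x \<le> upper y - upper x"
      by (simp add: width_def)
    let ?A = "Interval (lower y - lower x, upper y - upper x)"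
    have "lower ?A = lower y - lower x" "upper ?A = upper y - upper x"
      using le by (simp_all add: lower.rep_eq upper.rep_eq Interval_inverse)
    then have "X = diff_class 0 ?A"
      by (simp add: X diff_class_eq_iff_bounds)
    then show thesis by (rule neg)
  qed
qed

text \<open>
  Scalar multiplication, length and center are given by clauses on the representatives \<open>(A, 0)\<close>
  and \<open>(0, A)\<close>. They are introduced by definite description; the lemmas following each
  definition show that the clauses are consistent, so that the described value exists and is unique.
\<close>

instantiation diff_interval :: real_vector
begin

lift_definition zero_diff_interval :: diff_interval is "(0, 0)" .

lift_definition plus_diff_interval :: "diff_interval \<Rightarrow> diff_interval \<Rightarrow> diff_interval"
  is "\<lambda>(x, y) (z, t). (x + z, y + t)"
  by (auto simp: diff_rel_bounds)

lift_definition uminus_diff_interval :: "diff_interval \<Rightarrow> diff_interval"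
  is "\<lambda>(x, y). (y, x)"
  by (auto simp: diff_rel_bounds)

definition minus_diff_interval :: "diff_interval \<Rightarrow> diff_interval \<Rightarrow> diff_interval"
  where "minus_diff_interval X Y = X + - Y"

definition scaleR_diff_interval :: "real \<Rightarrow> diff_interval \<Rightarrow> diff_interval"
  where "scaleR_diff_interval \<alpha> X = (THE Y. \<exists>A.
    (X = diff_class A 0 \<and>
      Y = (if 0 \<le> \<alpha> then diff_class (scale_interval \<alpha> A) 0
           else diff_class 0 (scale_interval (- \<alpha>) A))) \<or>
    (X = diff_class 0 A \<and>
      Y = (if 0 \<le> \<alpha> then diff_class 0 (scale_interval \<alpha> A)
           else diff_class (scale_interval (- \<alpha>) A) 0)))"

lemma zero_diff_interval_eq: "0 = diff_class 0 0"
  by transfer (simp add: diff_rel_bounds)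

lemma diff_class_add: "diff_class x y + diff_class z t = diff_class (x + z) (y + t)"
  by transfer (simp add: diff_rel_bounds)

lemma uminus_diff_class: "- diff_class x y = diff_class y x"
  by transfer (simp add: diff_rel_bounds)

lemma scaleR_diff_class_left:
  "\<alpha> *\<^sub>R diff_class A 0 =
     (if 0 \<le> \<alpha> then diff_class (scale_interval \<alpha> A) 0
      else diff_class 0 (scale_interval (- \<alpha>) A))"
  unfolding scaleR_diff_interval_def
  by (rule the_equality)
    (auto simp: diff_class_eq_iff_bounds lower_scale_interval upper_scale_interval
      add_eq_0_iff)

lemma scaleR_diff_class_right:
  "\<alpha> *\<^sub>R diff_class 0 A =
     (if 0 \<le> \<alpha> then diff_class 0 (scale_interval \<alpha> A)
      else diff_class (scale_interval (- \<alpha>) A) 0)"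
  unfolding scaleR_diff_interval_def
  by (rule the_equality)
    (auto simp: diff_class_eq_iff_bounds lower_scale_interval upper_scale_interval
      add_eq_0_iff)

lemma scaleR_diff_class:
  "\<alpha> *\<^sub>R diff_class x y =
     (if 0 \<le> \<alpha> then diff_class (scale_interval \<alpha> x) (scale_interval \<alpha> y)
      else diff_class (scale_interval (- \<alpha>) y) (scale_interval (- \<alpha>) x))"
proof (cases "diff_class x y" rule: diff_interval_cases)
  case (pos A)
  then have "lower x = lower y + lower A" "upper x = upper y + upper A"
    by (simp_all add: diff_class_eq_iff_bounds)
  then show ?thesis
    unfolding pos scaleR_diff_class_left
    by (simp add: diff_class_eq_iff_bounds lower_scale_interval upper_scale_interval distrib_left)
next
  case (neg A)
  then have "lower y = lower x + lower A" "upper y = upper x + upper A"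
    by (simp_all add: diff_class_eq_iff_bounds)
  then show ?thesis
    unfolding neg scaleR_diff_class_right
    by (simp add: diff_class_eq_iff_bounds lower_scale_interval upper_scale_interval distrib_left)
qed

instance
proof
  fix X Y Z :: diff_interval and a b :: real
  obtain x x' where X: "X = diff_class x x'" by (rule diff_class_exhaust)
  obtain y y' where Y: "Y = diff_class y y'" by (rule diff_class_exhaust)
  obtain z z' where Z: "Z = diff_class z z'" by (rule diff_class_exhaust)
  note simps = X Y Z zero_diff_interval_eq diff_class_add uminus_diff_class minus_diff_interval_def
    scaleR_diff_class diff_class_eq_iff_bounds lower_scale_interval upper_scale_interval
  show "X + Y + Z = X + (Y + Z)" "X + Y = Y + X" "0 + X = X" "- X + X = 0" "X - Y = X + - Y"
    by (simp_all add: simps)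
  show "a *\<^sub>R (X + Y) = a *\<^sub>R X + a *\<^sub>R Y" "(a + b) *\<^sub>R X = a *\<^sub>R X + b *\<^sub>R X"
    "a *\<^sub>R b *\<^sub>R X = (a * b) *\<^sub>R X" "1 *\<^sub>R X = X"
    by (auto simp: simps algebra_simps not_le zero_le_mult_iff mult_le_0_iff)
qed

end

definition diff_length :: "diff_interval \<Rightarrow> real"
  where "diff_length X = (THE r. \<exists>A.
    (X = diff_class A 0 \<and> r = width A) \<or> (X = diff_class 0 A \<and> r = width A))"

definition diff_center :: "diff_interval \<Rightarrow> real"
  where "diff_center X = (THE r. \<exists>A.
    (X = diff_class A 0 \<and> r = center A) \<or> (X = diff_class 0 A \<and> r = - center A))"

lemma same_width:
  assumes "diff_class A 0 = diff_class 0 B"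
  shows "width A = width B"
proof -
  have "lower A + lower B = 0" "upper A + upper B = 0"
    using assms by (simp_all add: diff_class_eq_iff_bounds)
  then show ?thesis
    using lower_le_upper[of A] lower_le_upper[of B] unfolding width_def by linarith
qed

lemma diff_length_simps:
  "diff_length (diff_class A 0) = width A" "diff_length (diff_class 0 A) = width A"
  unfolding diff_length_def
  by (rule the_equality;
      auto dest: same_width same_width[OF sym] simp: diff_class_eq_iff[of _ 0 _ 0]
        diff_class_eq_iff[of 0 _ 0])+

lemma diff_center_simps:
  "diff_center (diff_class A 0) = center A" "diff_center (diff_class 0 A) = - center A"
  unfolding diff_center_def
  by (rule the_equality; auto simp: diff_class_eq_iff_bounds center_def field_simps)+

definition is_norm :: "('a::real_vector \<Rightarrow> real) \<Rightarrow> bool"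
  where "is_norm p \<longleftrightarrow>
    (\<forall>x. 0 \<le> p x) \<and>
    (\<forall>x. p x = 0 \<longleftrightarrow> x = 0) \<and>
    (\<forall>a x. p (a *\<^sub>R x) = \<bar>a\<bar> * p x) \<and>
    (\<forall>x y. p (x + y) \<le> p x + p y)"

end

theory Submission
  imports Defs
begin

text \<open>
  On the class of \<open>(x, y)\<close> the length is the absolute value of the linear functional
  \<open>width x - width y\<close>, and the center is the linear functional \<open>center x - center y\<close>. Hence the map
  is a sum of two seminorms, and it is definite because width and center determine the
  bounds of an interval.
\<close>

text \<open>Any class reduces to \<open>(A, 0)\<close> or \<open>(0, A)\<close>; then the bounds of
  \<open>x\<close> and \<open>y\<close> differ by those of \<open>A\<close>, and
  \<open>width A\<close> is nonnegative, so the absolute value absorbs the sign that separates the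
  two cases.\<close>

lemma diff_length_class: "diff_length (diff_class x y) = \<bar>width x - width y\<bar>"
proof (cases "diff_class x y" rule: diff_interval_cases)
  case (pos A)
  then have "lower x = lower y + lower A" "upper x = upper y + upper A"
    by (simp_all add: diff_class_eq_iff_bounds)
  then show ?thesis
    using lower_le_upper[of A] unfolding pos diff_length_simps width_def by linarith
next
  case (neg A)
  then have "lower y = lower x + lower A" "upper y = upper x + upper A"
    by (simp_all add: diff_class_eq_iff_bounds)
  then show ?thesis
    using lower_le_upper[of A] unfolding neg diff_length_simps width_def by linarith
qed

text \<open>The minus sign in the clause for \<open>(0, A)\<close> makes both cases agree, so no
  absolute value appears here.\<close>

lemma diff_center_class: "diff_center (diff_class x y) = center x - center y"
proof (cases "diff_class x y" rule: diff_interval_cases)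
  case (pos A)
  then have "lower x = lower y + lower A" "upper x = upper y + upper A"
    by (simp_all add: diff_class_eq_iff_bounds)
  then show ?thesis
    unfolding pos diff_center_simps center_def by (simp add: field_simps)
next
  case (neg A)
  then have "lower y = lower x + lower A" "upper y = upper x + upper A"
    by (simp_all add: diff_class_eq_iff_bounds)
  then show ?thesis
    unfolding neg diff_center_simps center_def by (simp add: field_simps)
qed

lemma width_scale_interval: "0 \<le> \<alpha> \<Longrightarrow> width (scale_interval \<alpha> A) = \<alpha> * width A"
  by (simp add: width_def lower_scale_interval upper_scale_interval right_diff_distrib)

lemma center_scale_interval: "0 \<le> \<alpha> \<Longrightarrow> center (scale_interval \<alpha> A) = \<alpha> * center A"
  by (simp add: center_def lower_scale_interval upper_scale_interval distrib_left)

lemma diff_length_nonneg: "0 \<le> diff_length X"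
  by (cases X rule: diff_class_exhaust) (simp add: diff_length_class)

lemma diff_length_scaleR: "diff_length (\<alpha> *\<^sub>R X) = \<bar>\<alpha>\<bar> * diff_length X"
proof -
  obtain x y where X: "X = diff_class x y" by (rule diff_class_exhaust)
  \<comment> \<open>For negative \<open>\<alpha>\<close> the components are swapped and scaled by
    \<open>- \<alpha>\<close>; the two sign changes cancel, so both branches give the same
    expression.\<close>
  have "diff_length (\<alpha> *\<^sub>R X) = \<bar>\<alpha> * (width x - width y)\<bar>"
    by (simp add: X scaleR_diff_class diff_length_class width_scale_interval algebra_simps)
  then show ?thesis
    by (simp add: X diff_length_class abs_mult)
qed

lemma diff_center_scaleR: "diff_center (\<alpha> *\<^sub>R X) = \<alpha> * diff_center X"
  by (cases X rule: diff_class_exhaust)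
    (simp add: scaleR_diff_class diff_center_class center_scale_interval algebra_simps)

text \<open>Widths add, so this is the triangle inequality for real absolute values.\<close>

lemma diff_length_add: "diff_length (X + Y) \<le> diff_length X + diff_length Y"
proof -
  obtain x x' where X: "X = diff_class x x'" by (rule diff_class_exhaust)
  obtain y y' where Y: "Y = diff_class y y'" by (rule diff_class_exhaust)
  show ?thesis
    by (simp add: X Y diff_class_add diff_length_class width_def)
qed

lemma diff_center_add: "diff_center (X + Y) = diff_center X + diff_center Y"
proof -
  obtain x x' where X: "X = diff_class x x'" by (rule diff_class_exhaust)
  obtain y y' where Y: "Y = diff_class y y'" by (rule diff_class_exhaust)
  show ?thesis
    by (simp add: X Y diff_class_add diff_center_class center_def field_simps)
qed

text \<open>The class of \<open>(x, y)\<close> is zero exactly when \<open>x\<close> and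
  \<open>y\<close> have the same bounds; equal widths and centers mean equal differences and sums of
  the bounds, hence equal bounds.\<close>

lemma diff_interval_eq_0_iff: "X = 0 \<longleftrightarrow> diff_length X = 0 \<and> diff_center X = 0"
proof -
  obtain x y where X: "X = diff_class x y" by (rule diff_class_exhaust)
  show ?thesis
    by (auto simp: X zero_diff_interval_eq diff_class_eq_iff_bounds diff_length_class
        diff_center_class width_def center_def)
qed

theorem theorem11:
  shows "is_norm (\<lambda>X :: diff_interval. diff_length X + \<bar>diff_center X\<bar>)"
  unfolding is_norm_def
proof (intro conjI allI)
  fix X Y :: diff_interval and a :: real
  show "0 \<le> diff_length X + \<bar>diff_center X\<bar>"
    by (simp add: diff_length_nonneg)
  show "diff_length X + \<bar>diff_center X\<bar> = 0 \<longleftrightarrow> X = 0"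
    \<comment> \<open>A sum of two nonnegative terms vanishes only if both do.\<close>
    by (simp add: diff_interval_eq_0_iff diff_length_nonneg add_nonneg_eq_0_iff)
  show "diff_length (a *\<^sub>R X) + \<bar>diff_center (a *\<^sub>R X)\<bar> = \<bar>a\<bar> * (diff_length X + \<bar>diff_center X\<bar>)"
    by (simp add: diff_length_scaleR diff_center_scaleR abs_mult distrib_left)
  show "diff_length (X + Y) + \<bar>diff_center (X + Y)\<bar>
      \<le> diff_length X + \<bar>diff_center X\<bar> + (diff_length Y + \<bar>diff_center Y\<bar>)"
    using diff_length_add[of X Y] abs_triangle_ineq[of "diff_center X" "diff_center Y"]
    by (simp add: diff_center_add)
qed

end
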